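(* Let $\Gamma$ be any nontrivial additive subgroup of $\mathbb{C}$ and let $W=W(\Gamma)$ be the complex Lie algebra with basis $\{L_{\alpha,i}\mid \alpha\in\Gamma,\ i\in\mathbb{Z}_+\}$ and bracket $$[L_{\alpha,i},L_{\beta,j}]=(\beta-\alpha)L_{\alpha+\beta,i+j}+(j-i)L_{\alpha+\beta,i+j+1}\qquad(\alpha,\beta\in\Gamma,\ i,j\in\mathbb{Z}_+).$$ Then $$\mathrm{Der}\,W=\mathrm{ad}\,W\oplus\mathrm{Hom}_{\mathbb{Z}}(\Gamma,\mathbb{C}),$$ where $\mathrm{Hom}_{\mathbb{Z}}(\Gamma,\mathbb{C})$ is identified with the subspace $\{D_\phi\mid\phi\in\mathrm{Hom}_{\mathbb{Z}}(\Gamma,\mathbb{C})\}$ of $\mathrm{Der}\,W$, with $D_\phi(L_{\alpha,i})=\phi(\alpha)L_{\alpha,i}$ for $\alpha\in\Gamma$, $i\in\mathbb{Z}_+$. In particular, if $\Gamma=\mathbb{Z}$, then $\mathrm{Der}\,W(\mathbb{Z})=\mathrm{ad}\,W(\mathbb{Z})\oplus\mathbb{C}D_0$, where $D_0(L_{\alpha,i})=\alpha L_{\alpha,i}$ for $\alpha\in\mathbb{Z}$, $i\in\mathbb{Z}_+$.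
   Context: $\mathbb{Z}_+$ denotes the set of nonnegative integers. "Nontrivial" means $\Gamma\neq\{0\}$. A derivation of $W$ is a ($\mathbb{C}$-)linear map $D:W\to W$ with $D([x,y])=[D(x),y]+[x,D(y)]$ for all $x,y\in W$. $\mathrm{Der}\,W$ is the vector space of all derivations of $W$, and $\mathrm{ad}\,W=\{\mathrm{ad}_z\mid z\in W\}$ (with $\mathrm{ad}_z(y)=[z,y]$) is the space of inner derivations. $\mathrm{Hom}_{\mathbb{Z}}(\Gamma,\mathbb{C})$ is the complex vector space of group homomorphisms from $\Gamma$ to the additive group $\mathbb{C}$, with $(c\phi)(\gamma)=c\phi(\gamma)$ for $c\in\mathbb{C}$. *)

theory Defs
  imports Complex_Main "HOL-Library.Poly_Mapping" "HOL-Library.Function_Algebras"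
begin

definition additive_subgroup :: "complex set \<Rightarrow> bool" where
  "additive_subgroup \<Gamma> \<longleftrightarrow>
     0 \<in> \<Gamma> \<and> (\<forall>\<alpha>\<in>\<Gamma>. \<forall>\<beta>\<in>\<Gamma>. \<alpha> + \<beta> \<in> \<Gamma>) \<and> (\<forall>\<alpha>\<in>\<Gamma>. - \<alpha> \<in> \<Gamma>)"

text \<open>
  Formal finite complex combinations of symbols indexed by pairs \<open>(\<alpha>, i)\<close>.  The space
  \<open>W(\<Gamma>)\<close> is the subspace of those combinations that only involve \<open>\<alpha> \<in> \<Gamma>\<close>.
\<close>

type_synonym wvec = "complex \<times> nat \<Rightarrow>\<^sub>0 complex"

definition scl :: "complex \<Rightarrow> wvec \<Rightarrow> wvec" where
  "scl c x = Poly_Mapping.map ((*) c) x"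

lemma lookup_scl [simp]: "Poly_Mapping.lookup (scl c x) k = c * Poly_Mapping.lookup x k"
  by (simp add: scl_def Poly_Mapping.map.rep_eq when_def)

global_interpretation wvec_vs: vector_space scl
  by unfold_locales (auto intro!: poly_mapping_eqI simp: lookup_add algebra_simps)

definition L :: "complex \<Rightarrow> nat \<Rightarrow> wvec" where
  "L \<alpha> i = Poly_Mapping.single (\<alpha>, i) 1"

definition W :: "complex set \<Rightarrow> wvec set" where
  "W \<Gamma> = {x. Poly_Mapping.keys x \<subseteq> \<Gamma> \<times> UNIV}"

text \<open>The linear extension of a map given on the basis vectors.\<close>

definition lin_ext :: "(complex \<Rightarrow> nat \<Rightarrow> wvec) \<Rightarrow> wvec \<Rightarrow> wvec" where
  "lin_ext f x = (\<Sum>(\<alpha>, i)\<in>Poly_Mapping.keys x. scl (Poly_Mapping.lookup x (\<alpha>, i)) (f \<alpha> i))"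

definition bracket :: "wvec \<Rightarrow> wvec \<Rightarrow> wvec" where
  "bracket x y =
     lin_ext (\<lambda>\<alpha> i. lin_ext (\<lambda>\<beta> j.
        scl (\<beta> - \<alpha>) (L (\<alpha> + \<beta>) (i + j)) + scl (of_nat j - of_nat i) (L (\<alpha> + \<beta>) (i + j + 1))) y) x"

text \<open>
  A linear map \<open>W \<Gamma> \<rightarrow> W \<Gamma>\<close> is represented by its extension by zero to the whole type, so that
  equality of maps on \<open>W \<Gamma>\<close> is equality of HOL functions; likewise for homomorphisms on \<open>\<Gamma>\<close>.
  Zero, sums and scalar multiples of such maps are then the pointwise ones.
\<close>

definition fscl :: "complex \<Rightarrow> (wvec \<Rightarrow> wvec) \<Rightarrow> (wvec \<Rightarrow> wvec)" where
  "fscl c D = (\<lambda>x. scl c (D x))"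

global_interpretation fun_vs: vector_space fscl
  by unfold_locales (auto simp: fscl_def fun_eq_iff wvec_vs.scale_right_distrib wvec_vs.scale_left_distrib)

definition Der :: "complex set \<Rightarrow> (wvec \<Rightarrow> wvec) set" where
  "Der \<Gamma> = {D.
     (\<forall>x\<in>W \<Gamma>. D x \<in> W \<Gamma>) \<and> (\<forall>x. x \<notin> W \<Gamma> \<longrightarrow> D x = 0) \<and>
     (\<forall>x\<in>W \<Gamma>. \<forall>y\<in>W \<Gamma>. D (x + y) = D x + D y) \<and>
     (\<forall>c. \<forall>x\<in>W \<Gamma>. D (scl c x) = scl c (D x)) \<and>
     (\<forall>x\<in>W \<Gamma>. \<forall>y\<in>W \<Gamma>. D (bracket x y) = bracket (D x) y + bracket x (D y))}"

definition ad :: "complex set \<Rightarrow> wvec \<Rightarrow> (wvec \<Rightarrow> wvec)" where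
  "ad \<Gamma> z = (\<lambda>y. if y \<in> W \<Gamma> then bracket z y else 0)"

definition adW :: "complex set \<Rightarrow> (wvec \<Rightarrow> wvec) set" where
  "adW \<Gamma> = ad \<Gamma> ` W \<Gamma>"

definition HomZ :: "complex set \<Rightarrow> (complex \<Rightarrow> complex) set" where
  "HomZ \<Gamma> = {\<phi>. (\<forall>\<alpha>\<in>\<Gamma>. \<forall>\<beta>\<in>\<Gamma>. \<phi> (\<alpha> + \<beta>) = \<phi> \<alpha> + \<phi> \<beta>) \<and> (\<forall>\<alpha>. \<alpha> \<notin> \<Gamma> \<longrightarrow> \<phi> \<alpha> = 0)}"

text \<open>The map \<open>D\<^sub>\<phi>\<close>; only the values of \<open>\<phi>\<close> on \<open>\<Gamma>\<close> matter.\<close>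

definition Dphi :: "complex set \<Rightarrow> (complex \<Rightarrow> complex) \<Rightarrow> (wvec \<Rightarrow> wvec)" where
  "Dphi \<Gamma> \<phi> = (\<lambda>x. if x \<in> W \<Gamma> then lin_ext (\<lambda>\<alpha> i. scl (\<phi> \<alpha>) (L \<alpha> i)) x else 0)"

definition D0 :: "wvec \<Rightarrow> wvec" where
  "D0 = Dphi \<int> (\<lambda>\<alpha>. \<alpha>)"

text \<open>\<open>V\<close> is the internal direct sum of its subspaces \<open>A\<close> and \<open>B\<close>.\<close>

definition is_direct_sum ::
  "(wvec \<Rightarrow> wvec) set \<Rightarrow> (wvec \<Rightarrow> wvec) set \<Rightarrow> (wvec \<Rightarrow> wvec) set \<Rightarrow> bool" where
  "is_direct_sum V A B \<longleftrightarrow>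
     fun_vs.subspace V \<and> fun_vs.subspace A \<and> fun_vs.subspace B \<and>
     V = {a + b |a b. a \<in> A \<and> b \<in> B} \<and> A \<inter> B = {0}"


subsection \<open>\<open>W \<Gamma>\<close> is a complex Lie algebra with basis \<open>L \<alpha> i\<close> and the intended bracket\<close>

lemma lin_ext_superset:
  assumes "finite S" "Poly_Mapping.keys x \<subseteq> S"
  shows "lin_ext f x = (\<Sum>(\<alpha>, i)\<in>S. scl (Poly_Mapping.lookup x (\<alpha>, i)) (f \<alpha> i))"
  unfolding lin_ext_def
  by (rule sum.mono_neutral_left) (use assms in \<open>auto simp: in_keys_iff\<close>)

lemma lin_ext_L [simp]: "lin_ext f (L \<alpha> i) = f \<alpha> i"
  by (simp add: lin_ext_def L_def)

lemma lin_ext_0 [simp]: "lin_ext f 0 = 0"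
  by (simp add: lin_ext_def)

lemma lin_ext_add: "lin_ext f (x + y) = lin_ext f x + lin_ext f y"
proof -
  let ?S = "Poly_Mapping.keys x \<union> Poly_Mapping.keys y"
  have "Poly_Mapping.keys (x + y) \<subseteq> ?S" by (rule keys_add)
  then show ?thesis
    by (simp add: lin_ext_superset[of ?S] lookup_add wvec_vs.scale_left_distrib
        case_prod_unfold sum.distrib)
qed

lemma keys_scl: "Poly_Mapping.keys (scl c x) \<subseteq> Poly_Mapping.keys x"
  by (auto simp: in_keys_iff)

lemma lin_ext_scl: "lin_ext f (scl c x) = scl c (lin_ext f x)"
  using keys_scl[of c x]
  by (simp add: lin_ext_superset[of "Poly_Mapping.keys x"] case_prod_unfold wvec_vs.scale_sum_right)

lemma lin_ext_add_fun: "lin_ext (\<lambda>\<alpha> i. f \<alpha> i + g \<alpha> i) x = lin_ext f x + lin_ext g x"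
  by (simp add: lin_ext_def wvec_vs.scale_right_distrib case_prod_unfold sum.distrib)

lemma lin_ext_scl_fun: "lin_ext (\<lambda>\<alpha> i. scl c (f \<alpha> i)) x = scl c (lin_ext f x)"
  by (simp add: lin_ext_def wvec_vs.scale_sum_right case_prod_unfold mult.commute)

lemma bracket_L:
  "bracket (L \<alpha> i) (L \<beta> j) =
     scl (\<beta> - \<alpha>) (L (\<alpha> + \<beta>) (i + j)) + scl (of_nat j - of_nat i) (L (\<alpha> + \<beta>) (i + j + 1))"
  by (simp add: bracket_def)

lemma bracket_add_left: "bracket (x + x') y = bracket x y + bracket x' y"
  by (simp add: bracket_def lin_ext_add)

lemma bracket_scl_left: "bracket (scl c x) y = scl c (bracket x y)"
  by (simp add: bracket_def lin_ext_scl)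

lemma bracket_add_right: "bracket x (y + y') = bracket x y + bracket x y'"
  by (simp add: bracket_def lin_ext_add lin_ext_add_fun)

lemma bracket_scl_right: "bracket x (scl c y) = scl c (bracket x y)"
  by (simp add: bracket_def lin_ext_scl lin_ext_scl_fun)

lemma bracket_0 [simp]: "bracket 0 y = 0" "bracket x 0 = 0"
  by (simp_all add: bracket_def) (simp add: lin_ext_def)

lemma wvec_induct [case_names zero L add scl]:
  assumes "P 0" "\<And>\<alpha> i. (\<alpha>, i) \<in> Poly_Mapping.keys x \<Longrightarrow> P (L \<alpha> i)" "\<And>x y. P x \<Longrightarrow> P y \<Longrightarrow> P (x + y)"
    "\<And>c x. P x \<Longrightarrow> P (scl c x)"
  shows "P x"
proof -
  have "x = lin_ext L x"
  proof (rule poly_mapping_eqI)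
    fix k
    have "Poly_Mapping.lookup (lin_ext L x) k = (\<Sum>l\<in>Poly_Mapping.keys x. if l = k then Poly_Mapping.lookup x l else 0)"
      unfolding lin_ext_def lookup_sum case_prod_unfold
      by (rule sum.cong) (auto simp: L_def lookup_single when_def)
    also have "\<dots> = Poly_Mapping.lookup x k" by (auto simp: in_keys_iff)
    finally show "Poly_Mapping.lookup x k = Poly_Mapping.lookup (lin_ext L x) k" ..
  qed
  moreover have "P (\<Sum>k\<in>S. scl (Poly_Mapping.lookup x k) (L (fst k) (snd k)))" if "finite S" "S \<subseteq> Poly_Mapping.keys x" for S
    using that by (induction S) (use assms in \<open>auto\<close>)
  ultimately show ?thesis by (metis (no_types, lifting) lin_ext_def case_prod_unfold finite_keys
        order_refl sum.cong prod.collapse)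
qed

lemma L_in_W: "\<alpha> \<in> \<Gamma> \<Longrightarrow> L \<alpha> i \<in> W \<Gamma>"
  by (simp add: L_def W_def)

lemma W_subspace: "wvec_vs.subspace (W \<Gamma>)"
  unfolding wvec_vs.subspace_def W_def using keys_add keys_scl by fastforce

lemma inj_L: "inj (\<lambda>(\<alpha>, i). L \<alpha> i)"
proof (rule injI)
  fix k l :: "complex \<times> nat"
  assume "(\<lambda>(\<alpha>, i). L \<alpha> i) k = (\<lambda>(\<alpha>, i). L \<alpha> i) l"
  then have "Poly_Mapping.keys ((\<lambda>(\<alpha>, i). L \<alpha> i) k) = Poly_Mapping.keys ((\<lambda>(\<alpha>, i). L \<alpha> i) l)" by simp
  then show "k = l" by (auto simp: L_def split: prod.splits)
qed

lemma W_span: "wvec_vs.span {L \<alpha> i |\<alpha> i. \<alpha> \<in> \<Gamma>} = W \<Gamma>"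
proof
  show "wvec_vs.span {L \<alpha> i |\<alpha> i. \<alpha> \<in> \<Gamma>} \<subseteq> W \<Gamma>"
    by (rule wvec_vs.span_minimal) (auto simp: L_in_W W_subspace)
  show "W \<Gamma> \<subseteq> wvec_vs.span {L \<alpha> i |\<alpha> i. \<alpha> \<in> \<Gamma>}"
  proof
    fix x assume x: "x \<in> W \<Gamma>"
    show "x \<in> wvec_vs.span {L \<alpha> i |\<alpha> i. \<alpha> \<in> \<Gamma>}"
    proof (induction x rule: wvec_induct)
      case (L \<alpha> i)
      then have "\<alpha> \<in> \<Gamma>" using x by (auto simp: W_def)
      then show ?case by (auto intro: wvec_vs.span_base)
    qed (auto simp: wvec_vs.span_zero wvec_vs.span_add wvec_vs.span_scale)
  qed
qed

lemma L_independent: "\<not> wvec_vs.dependent {L \<alpha> i |\<alpha> i. \<alpha> \<in> \<Gamma>}"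
proof
  assume "wvec_vs.dependent {L \<alpha> i |\<alpha> i. \<alpha> \<in> \<Gamma>}"
  then obtain a where a: "a \<in> {L \<alpha> i |\<alpha> i. \<alpha> \<in> \<Gamma>}"
    "a \<in> wvec_vs.span ({L \<alpha> i |\<alpha> i. \<alpha> \<in> \<Gamma>} - {a})"
    unfolding wvec_vs.dependent_def by blast
  then obtain \<alpha> i where ai: "a = L \<alpha> i" by blast
  have "wvec_vs.span ({L \<alpha> i |\<alpha> i. \<alpha> \<in> \<Gamma>} - {a}) \<subseteq> {x. Poly_Mapping.lookup x (\<alpha>, i) = 0}"
    by (rule wvec_vs.span_minimal)
       (auto simp: ai L_def lookup_single when_def wvec_vs.subspace_def lookup_add)
  then have "Poly_Mapping.lookup a (\<alpha>, i) = 0" using a(2) by blast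
  then show False by (simp add: ai L_def)
qed

lemma bracket_in_W:
  assumes "additive_subgroup \<Gamma>" "x \<in> W \<Gamma>" "y \<in> W \<Gamma>"
  shows "bracket x y \<in> W \<Gamma>"
proof -
  note W = wvec_vs.subspace_0[OF W_subspace] wvec_vs.subspace_add[OF W_subspace]
    wvec_vs.subspace_scale[OF W_subspace]
  have 1: "bracket (L \<alpha> i) y \<in> W \<Gamma>" if "\<alpha> \<in> \<Gamma>" for \<alpha> i
  proof (induction y rule: wvec_induct)
    case (L \<beta> j)
    then have "\<alpha> + \<beta> \<in> \<Gamma>" using assms that by (auto simp: additive_subgroup_def W_def)
    then show ?case unfolding bracket_L by (intro W L_in_W)
  qed (auto simp: W bracket_add_right bracket_scl_right)
  show ?thesis
  proof (induction x rule: wvec_induct)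
    case (L \<alpha> i)
    then have "\<alpha> \<in> \<Gamma>" using assms by (auto simp: W_def)
    then show ?case by (rule 1)
  qed (auto simp: W bracket_add_left bracket_scl_left)
qed

lemma bracket_skew: "bracket x y = - bracket y x"
proof (induction x rule: wvec_induct)
  case (L \<alpha> i)
  show ?case
    by (induction y rule: wvec_induct)
       (auto simp: bracket_L bracket_add_left bracket_add_right bracket_scl_left bracket_scl_right
          add.commute lookup_add algebra_simps intro!: poly_mapping_eqI)
qed (auto simp: bracket_add_left bracket_add_right bracket_scl_left bracket_scl_right)

lemma bracket_self: "bracket x x = 0"
proof -
  have "Poly_Mapping.lookup (bracket x x) k = - Poly_Mapping.lookup (bracket x x) k" for k
    using bracket_skew[of x x] by (metis lookup_uminus)
  then show ?thesis by (intro poly_mapping_eqI) simp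
qed

lemma bracket_Jacobi: "bracket x (bracket y z) + bracket y (bracket z x) + bracket z (bracket x y) = 0"
proof -
  note lin = bracket_add_left bracket_add_right bracket_scl_left bracket_scl_right
  have add: "a + a' + (b + b') + (c + c') = 0" if "a + b + c = 0" "a' + b' + c' = 0"
    for a a' b b' c c' :: wvec
    using that by (metis (no_types, lifting) add.assoc add.commute add_0)
  have scl: "scl r a + scl r b + scl r c = 0" if "a + b + c = 0" for r a b c
    using that by (metis wvec_vs.scale_right_distrib wvec_vs.scale_zero_right)
  show ?thesis
  proof (induction x rule: wvec_induct)
    case (L \<alpha> i)
    show ?case
    proof (induction y rule: wvec_induct)
      case (L \<beta> j)
      show ?case
      proof (induction z rule: wvec_induct)
        case (L \<gamma> k)
        show ?case
          by (rule poly_mapping_eqI)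
             (simp add: bracket_L lin lookup_add ac_simps, simp add: algebra_simps)
      qed (simp_all only: lin add scl bracket_0, simp_all)
    qed (simp_all only: lin add scl bracket_0, simp_all)
  qed (simp_all only: lin add scl bracket_0, simp_all)
qed

lemma ad_apply: "y \<in> W \<Gamma> \<Longrightarrow> ad \<Gamma> z y = bracket z y"
  by (simp add: ad_def)

lemma Dphi_L: "\<alpha> \<in> \<Gamma> \<Longrightarrow> Dphi \<Gamma> \<phi> (L \<alpha> i) = scl (\<phi> \<alpha>) (L \<alpha> i)"
  by (simp add: Dphi_def L_in_W)

lemma D0_L: "\<alpha> \<in> \<int> \<Longrightarrow> D0 (L \<alpha> i) = scl \<alpha> (L \<alpha> i)"
  by (simp add: D0_def Dphi_L)

end

theory Submission
  imports Defs "HOL-Library.Product_Plus"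
begin

text \<open>
  Write \<open>L \<alpha> i = x\<^sup>\<alpha> t\<^sup>i\<close> in the commutative algebra \<open>A = \<complex>[\<Gamma>] \<otimes> \<complex>[t]\<close>, and let \<open>d\<close> be its
  derivation with \<open>d x\<^sup>\<alpha> = \<alpha> x\<^sup>\<alpha>\<close> and \<open>d t = t\<^sup>2\<close>.  The bracket becomes
  \<open>[f, g] = f d g - g d f\<close>, so that \<open>ad 1 = d\<close>.

  Given a derivation \<open>D\<close> and \<open>0 \<noteq> \<beta> \<in> \<Gamma>\<close>, applying \<open>D\<close> to \<open>[1, x\<^sup>\<beta>] = \<beta> x\<^sup>\<beta>\<close> exhibits \<open>D 1\<close> as
  \<open>[w, 1]\<close> with \<open>w = (x\<^bsup>-\<beta>\<^esup> D x\<^sup>\<beta> - D 1) / \<beta>\<close>; subtracting \<open>ad w\<close> we may assume \<open>D 1 = 0\<close>.  Then \<open>D\<close>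
  commutes with \<open>d\<close>, so \<open>D x\<^sup>\<alpha>\<close> lies in the eigenspace \<open>\<complex> x\<^sup>\<alpha>\<close> of \<open>d\<close>, which yields an additive
  \<open>\<phi>\<close> with \<open>D x\<^sup>\<alpha> = \<phi>(\<alpha>) x\<^sup>\<alpha>\<close>; subtracting \<open>D\<^sub>\<phi>\<close> we may assume \<open>D x\<^sup>\<alpha> = 0\<close>.  Now
  \<open>h = x\<^bsup>-\<alpha>\<^esup> D(x\<^sup>\<alpha> t)\<close> turns out to be independent of \<open>\<alpha>\<close> and to satisfy \<open>d h = 2 t h\<close>, hence
  \<open>h = c t\<^sup>2\<close>.  So \<open>D\<close> is \<open>c\<close> times \<open>t\<^sup>2 \<partial>/\<partial>t\<close>, which equals \<open>ad 1 - D\<^sub>\<phi>\<close> for \<open>\<phi> = id\<close>.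
\<close>

section \<open>The commutative algebra behind the bracket and its derivation
  \<open>d\<close>\<close>

abbreviation X :: "complex \<Rightarrow> wvec" where "X \<alpha> \<equiv> L \<alpha> 0"
abbreviation T :: "wvec" where "T \<equiv> L 0 1"

text \<open>Scalars become constant elements of the algebra, so that \<open>algebra_simps\<close>
  can move them through products, which it cannot do with \<open>scl\<close>.\<close>

definition C :: "complex \<Rightarrow> wvec" where "C c = Poly_Mapping.single 0 c"

definition d :: "wvec \<Rightarrow> wvec" where
  "d = lin_ext (\<lambda>\<alpha> i. scl \<alpha> (L \<alpha> i) + scl (of_nat i) (L \<alpha> (i + 1)))"

text \<open>The product on \<open>wvec\<close> is the convolution of \<open>poly_mapping\<close> for
  the componentwise addition of index pairs; on basis vectors exponents simply add.\<close>

lemma L_mult: "L \<alpha> i * L \<beta> j = L (\<alpha> + \<beta>) (i + j)"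
  by (simp add: L_def mult_single)

lemma L_nonzero [simp]: "L \<alpha> i \<noteq> 0"
  by (metis L_def lookup_single_eq lookup_zero zero_neq_one)

lemma L_one: "L 0 0 = 1"
  by (simp add: L_def flip: single_one zero_prod_def)

lemma scl_conv: "scl c x = C c * x"
  by (simp add: scl_def C_def mult_map_scale_conv_mult)

lemma scl_mult: "scl c x * y = scl c (x * y)" "x * scl c y = scl c (x * y)"
  by (simp_all add: scl_conv)

lemma C_simps: "C 0 = 0" "C 1 = 1" "C (a + b) = C a + C b" "C (a - b) = C a - C b"
  "C (- a) = - C a" "C (a * b) = C a * C b"
  by (simp_all add: C_def single_add single_diff single_uminus mult_single flip: single_one)

lemma C_of_nat: "C (of_nat n) = of_nat n"
  by (induction n) (simp_all add: C_simps)

text \<open>\<open>X \<alpha>\<close> is a unit with inverse \<open>X (- \<alpha>)\<close>.\<close>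

lemma X_mult_cancel: "X \<alpha> * x = X \<alpha> * y \<longleftrightarrow> x = y"
proof
  assume "X \<alpha> * x = X \<alpha> * y"
  then have "X (- \<alpha>) * X \<alpha> * x = X (- \<alpha>) * X \<alpha> * y" by (simp only: mult.assoc)
  then show "x = y" by (simp add: L_mult L_one)
qed simp

lemma C_mult_cancel: "c \<noteq> 0 \<Longrightarrow> C c * x = C c * y \<longleftrightarrow> x = y"
  by (simp flip: scl_conv)

lemma d_L: "d (L \<alpha> i) = C \<alpha> * L \<alpha> i + of_nat i * L \<alpha> (i + 1)"
  by (simp add: d_def scl_conv C_of_nat)

lemma d_add: "d (x + y) = d x + d y" and d_scl: "d (C c * x) = C c * d x"
  and d_scl_vec: "d (scl c x) = scl c (d x)"
  by (simp_all add: d_def lin_ext_add lin_ext_scl flip: scl_conv)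

lemma d_uminus: "d (- x) = - d x"
  using d_scl[of "- 1" x] by (simp add: C_simps)

lemma d_diff: "d (x - y) = d x - d y"
  using d_add[of x "- y"] by (simp add: d_uminus)

lemma d_zero [simp]: "d 0 = 0"
  by (simp add: d_def)

text \<open>By bilinearity basis vectors suffice. There both coefficients in \<open>d_L\<close>,
  namely \<alpha> and i, are additive under multiplication.\<close>

lemma d_mult: "d (x * y) = x * d y + d x * y"
proof (induction x rule: wvec_induct)
  case (L \<alpha> i)
  show ?case
  proof (induction y rule: wvec_induct)
    case (L \<beta> j)
    show ?case by (simp add: L_mult d_L algebra_simps C_simps)
  qed (simp_all add: d_add algebra_simps d_scl_vec scl_mult wvec_vs.scale_right_distrib)
qed (simp_all add: d_add algebra_simps d_scl_vec scl_mult wvec_vs.scale_right_distrib)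

lemma d_one [simp]: "d 1 = 0"
  by (simp add: d_L C_simps flip: L_one)

lemma bracket_conv: "bracket x y = x * d y - d x * y"
proof (induction x rule: wvec_induct)
  case (L \<alpha> i)
  show ?case
  proof (induction y rule: wvec_induct)
    case (L \<beta> j)
    show ?case by (simp add: bracket_L L_mult d_L algebra_simps C_simps C_of_nat scl_conv)
  qed (simp_all add: bracket_add_right bracket_scl_right d_add algebra_simps d_scl_vec scl_mult flip: wvec_vs.scale_right_distrib)
qed (simp_all add: bracket_add_left bracket_scl_left d_add algebra_simps d_scl_vec scl_mult flip: wvec_vs.scale_right_distrib)

section \<open>Coefficient recursions for \<open>d\<close> and the equations they solve\<close>

lemma lookup_d:
  "Poly_Mapping.lookup (d x) (\<gamma>, j) =
     \<gamma> * Poly_Mapping.lookup x (\<gamma>, j) + of_nat (j - 1) * Poly_Mapping.lookup x (\<gamma>, j - 1)"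
proof (induction x rule: wvec_induct)
  case (L \<alpha> i)
  then show ?case
    \<comment> \<open>For j = 0 the truncated \<open>j - 1\<close> is 0, so the factor
      \<open>of_nat (j - 1)\<close> removes the second term.\<close>
    unfolding d_def lin_ext_L by (cases j) (auto simp: L_def lookup_add lookup_single when_def)
qed (simp_all add: d_add d_scl_vec lookup_add algebra_simps)

lemma lookup_T_mult:
  "Poly_Mapping.lookup (T * x) (\<gamma>, j) = (if j = 0 then 0 else Poly_Mapping.lookup x (\<gamma>, j - 1))"
proof (induction x rule: wvec_induct)
  case (L \<alpha> i)
  then show ?case
    by (cases j) (auto simp: L_mult, auto simp: L_def lookup_add lookup_single when_def)
next
  case (scl c x)
  have "T * scl c x = scl c (T * x)" by (simp add: scl_conv)
  with scl show ?case by simp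
qed (simp_all add: distrib_left lookup_add)

text \<open>\<open>d\<close> preserves the \<Gamma>-degree \<gamma> and acts triangularly in the
  power of t. For \<gamma> different from c the recursion kills the coefficients one after another
  from degree 0; for \<gamma> = c, the equation in degree j + 1 kills the coefficient of degree j
  unless j = 0.\<close>

lemma d_eigenvector:
  assumes "d x = scl c x"
  shows "x = scl (Poly_Mapping.lookup x (c, 0)) (X c)"
proof (rule poly_mapping_eqI)
  fix k :: "complex \<times> nat"
  obtain \<gamma> j where k: "k = (\<gamma>, j)" by (cases k)
  have rec: "(c - \<gamma>) * Poly_Mapping.lookup x (\<gamma>, j) = of_nat (j - 1) * Poly_Mapping.lookup x (\<gamma>, j - 1)" for j
    using lookup_d[of x \<gamma> j] assms by (simp add: algebra_simps)
  show "Poly_Mapping.lookup x k = Poly_Mapping.lookup (scl (Poly_Mapping.lookup x (c, 0)) (X c)) k"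
  proof (cases "\<gamma> = c")
    case True
    then show ?thesis
      using rec[of "Suc j"] by (auto simp: k L_def lookup_single when_def)
  next
    case False
    have "Poly_Mapping.lookup x (\<gamma>, j) = 0"
    proof (induction j)
      case 0
      then show ?case using rec[of 0] False by simp
    next
      case (Suc j)
      then show ?case using rec[of "Suc j"] False by simp
    qed
    then show ?thesis using False by (simp add: k L_def lookup_single when_def)
  qed
qed

text \<open>The same recursion with a shifted right-hand side: for \<gamma> = 0 the coefficient of
  degree j is multiplied by j - 2, so only degree 2 survives.\<close>

lemma d_eq_2T_imp:
  assumes "d x = 2 * T * x"
  shows "x = scl (Poly_Mapping.lookup x (0, 2)) (L 0 2)"
proof (rule poly_mapping_eqI)
  fix k :: "complex \<times> nat"
  obtain \<gamma> j where k: "k = (\<gamma>, j)" by (cases k)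
  have "d x = T * x + T * x" using assms by (simp add: algebra_simps)
  then have rec: "\<gamma> * Poly_Mapping.lookup x (\<gamma>, j) + of_nat (j - 1) * Poly_Mapping.lookup x (\<gamma>, j - 1)
      = (if j = 0 then 0 else 2 * Poly_Mapping.lookup x (\<gamma>, j - 1))" for j
    using lookup_d[of x \<gamma> j] unfolding \<open>d x = T * x + T * x\<close> lookup_add lookup_T_mult
    by (cases j) (auto simp: algebra_simps)
  show "Poly_Mapping.lookup x k = Poly_Mapping.lookup (scl (Poly_Mapping.lookup x (0, 2)) (L 0 2)) k"
  proof (cases "\<gamma> = 0")
    case True
    have "(of_nat j - 2) * Poly_Mapping.lookup x (\<gamma>, j) = 0"
      using rec[of "Suc j"] True by (simp add: algebra_simps)
    then have "j = 2 \<or> Poly_Mapping.lookup x (\<gamma>, j) = 0"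
      by (metis eq_iff_diff_eq_0 mult_eq_0_iff of_nat_eq_iff of_nat_numeral)
    then show ?thesis
      using True by (auto simp: k L_def lookup_single when_def)
  next
    case False
    have "Poly_Mapping.lookup x (\<gamma>, j) = 0"
    proof (induction j)
      case 0
      then show ?case using rec[of 0] False by simp
    next
      case (Suc j)
      then show ?case using rec[of "Suc j"] False by simp
    qed
    then show ?thesis using False by (simp add: k L_def lookup_single when_def)
  qed
qed

section \<open>Derivations of \<open>W \<Gamma>\<close>: closure properties, inner derivations and
  the maps \<open>Dphi\<close>\<close>

lemma W_mult:
  assumes "additive_subgroup \<Gamma>" "x \<in> W \<Gamma>" "y \<in> W \<Gamma>"
  shows "x * y \<in> W \<Gamma>"
  unfolding W_def
proof (intro CollectI subsetI)
  fix k assume "k \<in> Poly_Mapping.keys (x * y)"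
  then obtain a b where "a \<in> Poly_Mapping.keys x" "b \<in> Poly_Mapping.keys y" "k = a + b"
    using keys_mult[of x y] by blast
  then have "fst k = fst a + fst b" "fst a \<in> \<Gamma>" "fst b \<in> \<Gamma>"
    using assms(2,3) by (auto simp: W_def)
  with assms(1) show "k \<in> \<Gamma> \<times> UNIV"
    by (simp add: additive_subgroup_def mem_Times_iff)
qed

lemmas W_closed = wvec_vs.subspace_0[OF W_subspace] wvec_vs.subspace_add[OF W_subspace]
  wvec_vs.subspace_diff[OF W_subspace] wvec_vs.subspace_scale[OF W_subspace] L_in_W

lemma DerD:
  assumes "D \<in> Der \<Gamma>"
  shows "x \<in> W \<Gamma> \<Longrightarrow> D x \<in> W \<Gamma>" "x \<notin> W \<Gamma> \<Longrightarrow> D x = 0"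
    "x \<in> W \<Gamma> \<Longrightarrow> y \<in> W \<Gamma> \<Longrightarrow> D (x + y) = D x + D y"
    "x \<in> W \<Gamma> \<Longrightarrow> D (scl c x) = scl c (D x)"
    "x \<in> W \<Gamma> \<Longrightarrow> y \<in> W \<Gamma> \<Longrightarrow> D (bracket x y) = bracket (D x) y + bracket x (D y)"
  using assms unfolding Der_def by blast+

lemma Der_lincomb:
  assumes "D \<in> Der \<Gamma>" "x \<in> W \<Gamma>" "y \<in> W \<Gamma>"
  shows "D (scl a x + scl b y) = scl a (D x) + scl b (D y)"
  using assms by (simp add: DerD[OF assms(1)] W_closed)

lemma Der_subspace: "fun_vs.subspace (Der \<Gamma>)"
  unfolding fun_vs.subspace_def
proof (intro conjI ballI allI)
  show "0 \<in> Der \<Gamma>"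
    by (simp add: Der_def W_closed)
  show "D + E \<in> Der \<Gamma>" if "D \<in> Der \<Gamma>" "E \<in> Der \<Gamma>" for D E
    unfolding Der_def using DerD[OF that(1)] DerD[OF that(2)]
    by (auto simp: W_closed wvec_vs.scale_right_distrib bracket_add_left bracket_add_right)
  show "fscl c D \<in> Der \<Gamma>" if "D \<in> Der \<Gamma>" for c D
    unfolding Der_def fscl_def using DerD[OF that]
    by (auto simp: W_closed wvec_vs.scale_right_distrib bracket_scl_left bracket_scl_right mult.commute)
qed

lemma Der_eqI:
  assumes "D \<in> Der \<Gamma>" "E \<in> Der \<Gamma>" and "\<And>\<alpha> i. \<alpha> \<in> \<Gamma> \<Longrightarrow> D (L \<alpha> i) = E (L \<alpha> i)"
  shows "D = E"
proof
  fix x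
  note D = DerD[OF assms(1)] and E = DerD[OF assms(2)]
  have "wvec_vs.span {L \<alpha> i |\<alpha> i. \<alpha> \<in> \<Gamma>} \<subseteq> {x \<in> W \<Gamma>. D x = E x}"
  proof (rule wvec_vs.span_minimal)
    have "D 0 = 0" "E 0 = 0"
      using D(4)[of 0 0] E(4)[of 0 0] by (simp_all add: W_closed)
    then show "wvec_vs.subspace {x \<in> W \<Gamma>. D x = E x}"
      by (auto simp: wvec_vs.subspace_def W_closed D E)
  qed (auto simp: assms(3) L_in_W)
  then show "D x = E x"
    using W_span D(2) E(2) by (cases "x \<in> W \<Gamma>") auto
qed

text \<open>After \<open>bracket_conv\<close>, the derivation rule is an identity in a commutative
  ring with derivation \<open>d\<close>.\<close>

lemma ad_in_Der:
  assumes "additive_subgroup \<Gamma>" "z \<in> W \<Gamma>"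
  shows "ad \<Gamma> z \<in> Der \<Gamma>"
  using assms
  by (auto simp: Der_def ad_def W_closed bracket_in_W bracket_add_right bracket_scl_right)
     (simp add: bracket_conv d_mult d_diff algebra_simps)

lemma lin_ext_diagonal_in_W:
  assumes "x \<in> W \<Gamma>"
  shows "lin_ext (\<lambda>\<alpha> i. scl (\<phi> \<alpha>) (L \<alpha> i)) x \<in> W \<Gamma>"
proof -
  have "fst k \<in> \<Gamma>" if "k \<in> Poly_Mapping.keys x" for k
    using assms that by (auto simp: W_def)
  then show ?thesis
    unfolding lin_ext_def case_prod_unfold
    by (intro wvec_vs.subspace_sum[OF W_subspace] W_closed) auto
qed

lemma Dphi_in_Der:
  assumes G: "additive_subgroup \<Gamma>" and \<phi>: "\<phi> \<in> HomZ \<Gamma>"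
  shows "Dphi \<Gamma> \<phi> \<in> Der \<Gamma>"
proof -
  \<comment> \<open>\<open>?P\<close> is \<open>Dphi\<close> without the cut-off outside
    \<open>W \<Gamma>\<close>, hence linear on the whole type.\<close>
  let ?P = "lin_ext (\<lambda>\<alpha> i. scl (\<phi> \<alpha>) (L \<alpha> i))"
  note lin = bracket_add_left bracket_add_right bracket_scl_left bracket_scl_right lin_ext_add lin_ext_scl
    wvec_vs.scale_right_distrib
  have 1: "?P (bracket (L \<alpha> i) y) = bracket (?P (L \<alpha> i)) y + bracket (L \<alpha> i) (?P y)"
    if "\<alpha> \<in> \<Gamma>" "y \<in> W \<Gamma>" for \<alpha> i y
    using that(2)[folded W_span]
  proof (induction y rule: wvec_vs.span_induct_alt)
    case (step c x y)
    then obtain \<beta> j where x: "x = L \<beta> j" "\<beta> \<in> \<Gamma>" by blast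
    have "\<phi> (\<alpha> + \<beta>) = \<phi> \<alpha> + \<phi> \<beta>" using \<phi> that x by (auto simp: HomZ_def)
    with step show ?case 
      by (simp add: x bracket_L lin) (simp add: scl_conv C_simps algebra_simps)
  qed simp
  have "?P (bracket x y) = bracket (?P x) y + bracket x (?P y)" if "x \<in> W \<Gamma>" "y \<in> W \<Gamma>" for x y
    using that(1)[folded W_span]
  proof (induction x rule: wvec_vs.span_induct_alt)
    case (step c x z)
    then obtain \<alpha> i where x: "x = L \<alpha> i" "\<alpha> \<in> \<Gamma>" by blast
    show ?case
      using step 1[OF x(2) that(2), of i] unfolding x(1)
      by (simp only: lin) (simp add: algebra_simps)
  qed simp
  then show ?thesis
    by (simp add: Der_def Dphi_def W_closed lin lin_ext_diagonal_in_W bracket_in_W[OF G])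
qed

section \<open>Normalising a derivation on 1, on the \<open>X \<alpha>\<close>, and on all of the
  basis\<close>

lemma Der_one_inner:
  assumes G: "additive_subgroup \<Gamma>" and D: "D \<in> Der \<Gamma>" and "\<beta> \<in> \<Gamma>" "\<beta> \<noteq> 0"
  obtains w where "w \<in> W \<Gamma>" "D 1 = bracket w 1"
proof
  \<comment> \<open>Since \<open>bracket w 1\<close> equals \<open>- d w\<close>, the goal is
    \<open>d w = - D 1\<close>.\<close>
  define w where "w = scl (1 / \<beta>) (X (- \<beta>) * D (X \<beta>) - D 1)"
  have "- \<beta> \<in> \<Gamma>" "0 \<in> \<Gamma>" using G assms by (auto simp: additive_subgroup_def)
  then have one: "1 \<in> W \<Gamma>" using L_in_W[of 0 \<Gamma> 0] by (simp add: L_one)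
  show "w \<in> W \<Gamma>"
    unfolding w_def using \<open>- \<beta> \<in> \<Gamma>\<close> \<open>\<beta> \<in> \<Gamma>\<close> one
    by (intro W_closed W_mult[OF G] DerD(1)[OF D]) auto
  let ?v = "D (X \<beta>)"
  have 1: "X (- \<beta>) * X \<beta> = 1" by (simp add: L_mult L_one)
  have 2: "bracket 1 (X \<beta>) = scl \<beta> (X \<beta>)"
    by (simp add: bracket_conv d_L scl_conv)
  \<comment> \<open>This is \<open>D\<close> applied to both sides of fact \<open>2\<close>, with
    the brackets written out through \<open>d\<close>.\<close>
  have 3: "D 1 * (C \<beta> * X \<beta>) - d (D 1) * X \<beta> + d ?v = C \<beta> * ?v"
    using DerD(5)[OF D one, of "X \<beta>"] DerD(4)[OF D, of "X \<beta>" \<beta>] \<open>\<beta> \<in> \<Gamma>\<close>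
    by (simp add: 2 L_in_W bracket_conv d_L scl_conv)
  have "d (X (- \<beta>) * ?v) = C (- \<beta>) * X (- \<beta>) * ?v + X (- \<beta>) * d ?v"
    by (simp add: d_mult d_L)
  moreover have "X (- \<beta>) * d ?v = X (- \<beta>) * (C \<beta> * ?v) - X (- \<beta>) * X \<beta> * (D 1 * C \<beta>) + X (- \<beta>) * X \<beta> * d (D 1)"
  proof -
    have dv: "d ?v = C \<beta> * ?v - D 1 * (C \<beta> * X \<beta>) + d (D 1) * X \<beta>"
      using 3 by (simp add: algebra_simps)
    show ?thesis unfolding dv by (simp add: algebra_simps)
  qed
  ultimately have "d (X (- \<beta>) * ?v - D 1) = - (C \<beta> * D 1)"
    unfolding 1 d_diff C_simps by (simp add: algebra_simps)
  then have "d w = - (C (1 / \<beta>) * C \<beta> * D 1)"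
    unfolding w_def d_scl_vec by (simp add: scl_conv algebra_simps)
  also have "C (1 / \<beta>) * C \<beta> = 1"
    using \<open>\<beta> \<noteq> 0\<close> C_simps(2) by (simp flip: C_simps(6))
  finally show "D 1 = bracket w 1"
    by (simp add: bracket_conv)
qed

lemma Der_X_eigenvalue:
  assumes G: "additive_subgroup \<Gamma>" and D: "D \<in> Der \<Gamma>" and D1: "D 1 = 0"
  obtains \<phi> where "\<phi> \<in> HomZ \<Gamma>" "\<And>\<alpha>. \<alpha> \<in> \<Gamma> \<Longrightarrow> D (X \<alpha>) = scl (\<phi> \<alpha>) (X \<alpha>)"
proof
  \<comment> \<open>The eigenvalue is read off as a coefficient; the value 0 outside \<Gamma> is the
    convention of \<open>HomZ\<close>.\<close>
  define \<phi> where "\<phi> \<alpha> = (if \<alpha> \<in> \<Gamma> then Poly_Mapping.lookup (D (X \<alpha>)) (\<alpha>, 0) else 0)" for \<alpha>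
  have G0: "0 \<in> \<Gamma>" and Gadd: "\<And>\<alpha> \<beta>. \<alpha> \<in> \<Gamma> \<Longrightarrow> \<beta> \<in> \<Gamma> \<Longrightarrow> \<alpha> + \<beta> \<in> \<Gamma>"
    and Gminus: "\<And>\<alpha>. \<alpha> \<in> \<Gamma> \<Longrightarrow> - \<alpha> \<in> \<Gamma>"
    using G by (auto simp: additive_subgroup_def)
  have one: "1 \<in> W \<Gamma>" using L_in_W[of 0 \<Gamma> 0] G0 by (simp add: L_one)
  show DX: "D (X \<alpha>) = scl (\<phi> \<alpha>) (X \<alpha>)" if "\<alpha> \<in> \<Gamma>" for \<alpha>
  proof -
    have "bracket 1 (X \<alpha>) = scl \<alpha> (X \<alpha>)"
      by (simp add: bracket_conv d_L scl_conv)
    then have "d (D (X \<alpha>)) = scl \<alpha> (D (X \<alpha>))"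
      using DerD(5)[OF D one, of "X \<alpha>"] DerD(4)[OF D, of "X \<alpha>" \<alpha>] that D1
      by (simp add: L_in_W bracket_conv)
    from d_eigenvector[OF this] show ?thesis
      using that by (simp add: \<phi>_def)
  qed
  \<comment> \<open>\<open>X (\<alpha> + \<beta>)\<close> occurs in the bracket with factor \<beta>
    - \<alpha>, which can be cancelled only for distinct arguments.\<close>
  have add: "\<phi> (\<alpha> + \<beta>) = \<phi> \<alpha> + \<phi> \<beta>" if "\<alpha> \<in> \<Gamma>" "\<beta> \<in> \<Gamma>" "\<alpha> \<noteq> \<beta>" for \<alpha> \<beta>
  proof -
    have "D (bracket (X \<alpha>) (X \<beta>)) = scl (\<beta> - \<alpha>) (D (X (\<alpha> + \<beta>)))"
      using that by (simp add: bracket_L DerD[OF D] Gadd L_in_W)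
    moreover have "D (bracket (X \<alpha>) (X \<beta>)) = scl ((\<beta> - \<alpha>) * (\<phi> \<alpha> + \<phi> \<beta>)) (X (\<alpha> + \<beta>))"
      using that by (simp add: DerD[OF D] L_in_W DX bracket_scl_left bracket_scl_right)
        (simp add: bracket_L scl_conv C_simps algebra_simps)
    ultimately show ?thesis
      using that by (auto simp: DX Gadd)
  qed
  have \<phi>0: "\<phi> 0 = 0" using D1 by (simp add: \<phi>_def L_one)
  have "\<phi> (\<alpha> + \<alpha>) = \<phi> \<alpha> + \<phi> \<alpha>" if "\<alpha> \<in> \<Gamma>" for \<alpha>
  proof (cases "\<alpha> = 0")
    case False
    \<comment> \<open>\<open>add\<close> excludes equal arguments, so split \<open>\<alpha>\<close> as \<open>2\<alpha> + (-\<alpha>)\<close>.\<close>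
    then have "\<alpha> + \<alpha> \<noteq> - \<alpha>" "\<alpha> \<noteq> - \<alpha>"
      by (auto simp: eq_neg_iff_add_eq_0 simp flip: mult_2)
    with that have "\<phi> \<alpha> = \<phi> (\<alpha> + \<alpha>) + \<phi> (- \<alpha>)" "\<phi> \<alpha> + \<phi> (- \<alpha>) = 0"
      using add[OF Gadd[OF that that] Gminus[OF that]] add[OF that Gminus[OF that]] by (simp_all add: \<phi>0)
    then show ?thesis by algebra
  qed (simp add: \<phi>0)
  with add have "\<phi> (\<alpha> + \<beta>) = \<phi> \<alpha> + \<phi> \<beta>" if "\<alpha> \<in> \<Gamma>" "\<beta> \<in> \<Gamma>" for \<alpha> \<beta>
    using that by metis
  then show "\<phi> \<in> HomZ \<Gamma>"
    by (auto simp: HomZ_def \<phi>_def)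
qed

lemma Der_kills_X:
  assumes G: "additive_subgroup \<Gamma>" "\<Gamma> \<noteq> {0}" and D: "D \<in> Der \<Gamma>"
    and DX: "\<And>\<alpha>. \<alpha> \<in> \<Gamma> \<Longrightarrow> D (X \<alpha>) = 0"
  obtains c where "\<And>\<alpha> i. \<alpha> \<in> \<Gamma> \<Longrightarrow> D (L \<alpha> i) = scl (c * of_nat i) (L \<alpha> (i + 1))"
proof -
  have G0: "0 \<in> \<Gamma>" and Gadd: "\<And>\<alpha> \<beta>. \<alpha> \<in> \<Gamma> \<Longrightarrow> \<beta> \<in> \<Gamma> \<Longrightarrow> \<alpha> + \<beta> \<in> \<Gamma>"
    and Gminus: "\<And>\<alpha>. \<alpha> \<in> \<Gamma> \<Longrightarrow> - \<alpha> \<in> \<Gamma>"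
    using G by (auto simp: additive_subgroup_def)
  have one: "1 \<in> W \<Gamma>" using L_in_W[of 0 \<Gamma> 0] G0 by (simp add: L_one)
  have D1: "D 1 = 0" using DX[OF G0] by (simp add: L_one)
  have XX: "X \<alpha> * X (- \<alpha>) = 1" for \<alpha> by (simp add: L_mult L_one)
  \<comment> \<open>\<open>D\<close> commutes with \<open>d\<close> because \<open>D 1 = 0\<close>.
    The relation determines \<open>D\<close> in t-degree i + 1 from degree i, except for i = 0,
    where the left side vanishes; degree 1 is therefore studied separately through
    \<open>h\<close>.\<close>
  have step: "of_nat i * D (L \<alpha> (Suc i)) = d (D (L \<alpha> i)) - C \<alpha> * D (L \<alpha> i)" if "\<alpha> \<in> \<Gamma>" for \<alpha> i
  proof -
    have "bracket 1 (L \<alpha> i) = scl \<alpha> (L \<alpha> i) + scl (of_nat i) (L \<alpha> (Suc i))"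
      by (simp add: bracket_conv d_L scl_conv C_of_nat)
    then have "d (D (L \<alpha> i)) = D (scl \<alpha> (L \<alpha> i) + scl (of_nat i) (L \<alpha> (Suc i)))"
      using DerD(5)[OF D one, of "L \<alpha> i"] that D1 by (simp add: L_in_W bracket_conv)
    then show ?thesis
      using that by (simp add: DerD[OF D] W_closed) (simp add: scl_conv C_of_nat)
  qed
  define h where "h \<alpha> = X (- \<alpha>) * D (L \<alpha> 1)" for \<alpha>
  have H: "D (L \<alpha> (Suc 0)) = X \<alpha> * h \<alpha>" for \<alpha>
    using XX[of \<alpha>] by (simp add: h_def flip: mult.assoc)
  have H2: "D (L \<alpha> (Suc (Suc 0))) = X \<alpha> * d (h \<alpha>)" if "\<alpha> \<in> \<Gamma>" for \<alpha>
    using step[OF that, of 1] by (simp add: H d_mult d_L algebra_simps)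
  have diff: "h \<alpha> - h \<sigma> = scl (Poly_Mapping.lookup (h \<alpha> - h \<sigma>) (\<sigma> - 2 * \<alpha>, 0)) (X (\<sigma> - 2 * \<alpha>))"
    if "\<alpha> \<in> \<Gamma>" "\<sigma> \<in> \<Gamma>" for \<alpha> \<sigma>
  proof (rule d_eigenvector)
    \<comment> \<open>Here \<open>D\<close> is applied to the bracket of \<open>L \<alpha> 1\<close>
      and \<open>X \<beta>\<close>, which lies in \<Gamma>-degree \<sigma>. As \<open>D\<close>
      kills \<open>X \<beta>\<close>, the outcome relates \<open>h \<alpha>\<close> to
      \<open>h \<sigma>\<close> alone.\<close>
    define \<beta> where "\<beta> = \<sigma> - \<alpha>"
    have \<beta>: "\<beta> \<in> \<Gamma>" "\<sigma> = \<alpha> + \<beta>"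
      using Gadd[OF that(2) Gminus[OF that(1)]] by (simp_all add: \<beta>_def)
    have "bracket (D (L \<alpha> 1)) (X \<beta>) = D (scl (\<beta> - \<alpha>) (L \<sigma> 1) + scl (- 1) (L \<sigma> 2))"
      using DerD(5)[OF D, of "L \<alpha> 1" "X \<beta>"] that \<beta>
      by (simp add: L_in_W DX bracket_L numeral_2_eq_2)
    also have "\<dots> = C (\<beta> - \<alpha>) * D (L \<sigma> 1) - D (L \<sigma> 2)"
      unfolding Der_lincomb[OF D L_in_W[OF that(2)] L_in_W[OF that(2)]] by (simp add: scl_conv C_simps)
    finally have *: "bracket (X \<alpha> * h \<alpha>) (X \<beta>) = X \<sigma> * (C (\<beta> - \<alpha>) * h \<sigma> - d (h \<sigma>))"
      using that by (simp add: H H2 numeral_2_eq_2 right_diff_distrib mult.left_commute)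
    have "bracket (X \<alpha> * h \<alpha>) (X \<beta>) = X \<alpha> * X \<beta> * (C (\<beta> - \<alpha>) * h \<alpha> - d (h \<alpha>))"
      by (simp add: bracket_conv d_mult d_L C_simps algebra_simps)
    also have "X \<alpha> * X \<beta> = X \<sigma>" by (simp add: \<beta> L_mult)
    finally have "C (\<beta> - \<alpha>) * h \<alpha> - d (h \<alpha>) = C (\<beta> - \<alpha>) * h \<sigma> - d (h \<sigma>)"
      unfolding * X_mult_cancel by (rule sym)
    moreover have "\<sigma> - 2 * \<alpha> = \<beta> - \<alpha>" by (simp add: \<beta>)
    ultimately show "d (h \<alpha> - h \<sigma>) = scl (\<sigma> - 2 * \<alpha>) (h \<alpha> - h \<sigma>)"
      by (simp only: scl_conv d_diff) (simp add: algebra_simps)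
  qed
  \<comment> \<open>By \<open>diff\<close> and its mirror image, \<open>h \<alpha> - h 0\<close> is a multiple of both \<open>x\<^bsup>-2\<alpha>\<^esup>\<close> and \<open>x\<^sup>\<alpha>\<close>.\<close>
  have h_const: "h \<alpha> = h 0" if "\<alpha> \<in> \<Gamma>" for \<alpha>
  proof (cases "\<alpha> = 0")
    case False
    define a b where "a = Poly_Mapping.lookup (h \<alpha> - h 0) (0 - 2 * \<alpha>, 0)"
      and "b = Poly_Mapping.lookup (h 0 - h \<alpha>) (\<alpha> - 2 * 0, 0)"
    have a: "h \<alpha> - h 0 = scl a (X (- 2 * \<alpha>))"
      using diff[OF that G0] unfolding a_def by simp
    have b: "h 0 - h \<alpha> = scl b (X \<alpha>)"
      using diff[OF G0 that] unfolding b_def by simp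
    have "scl a (X (- 2 * \<alpha>)) = - scl b (X \<alpha>)" using a b by (metis minus_diff_eq)
    from arg_cong[OF this, of "\<lambda>x. Poly_Mapping.lookup x (\<alpha>, 0)"] have "b = 0"
      using False by (auto simp: L_def lookup_single when_def eq_neg_iff_add_eq_0)
    with b show ?thesis by simp
  qed simp
  obtain \<beta> where \<beta>: "\<beta> \<in> \<Gamma>" "\<beta> \<noteq> 0" using G G0 by blast
  \<comment> \<open>A second relation for \<open>h 0\<close>: both arguments have t-degree 1, so the
    t-cubed term of their bracket cancels and only \<beta> times \<open>L \<beta> 2\<close> remains.
    Evaluating \<open>D\<close> on it in two ways gives
    \<open>d (h 0) = 2 * T * h 0\<close>.\<close>
  have "D (bracket T (L \<beta> 1)) = scl \<beta> (D (L \<beta> 2))"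
    using \<beta> by (simp add: bracket_L DerD[OF D] L_in_W numeral_2_eq_2)
  also have "\<dots> = C \<beta> * (X \<beta> * d (h 0))"
    using H2 h_const \<beta> by (simp add: scl_conv numeral_2_eq_2)
  finally have 1: "C \<beta> * (X \<beta> * d (h 0)) = bracket (D T) (L \<beta> 1) + bracket T (D (L \<beta> 1))"
    using \<beta> G0 by (simp add: DerD[OF D] L_in_W)
  have LT: "L \<beta> (Suc 0) = X \<beta> * T" by (simp add: L_mult)
  have DT: "D T = h 0" using H[of 0] by (simp add: L_one)
  have dT: "d T = T * T" by (simp add: d_L C_simps L_mult numeral_2_eq_2)
  have "C \<beta> * (X \<beta> * d (h 0)) = C \<beta> * (X \<beta> * (2 * T * h 0))"
    unfolding 1 DT using H[of \<beta>] h_const[OF \<beta>(1)]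
    by (simp add: LT bracket_conv d_mult d_L[of \<beta>] dT[simplified] algebra_simps)
  then have "d (h 0) = 2 * T * h 0"
    unfolding C_mult_cancel[OF \<beta>(2)] X_mult_cancel .
  from d_eq_2T_imp[OF this] obtain c where c: "h 0 = scl c (L 0 2)" by blast
  have "D (L \<alpha> i) = scl (c * of_nat i) (L \<alpha> (i + 1))" if "\<alpha> \<in> \<Gamma>" for \<alpha> i
  proof (induction i)
    case 0
    then show ?case using that by (simp add: DX)
  next
    case (Suc i)
    show ?case
    \<comment> \<open>Division by i in \<open>step\<close> is possible only for positive i; the
      passage from degree 0 to degree 1 uses the known value of \<open>h 0\<close>.\<close>
    proof (cases "i = 0")
      case True
      then show ?thesis
        using H[of \<alpha>] h_const[OF that] c by (simp add: scl_conv L_mult numeral_2_eq_2 mult.left_commute)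
    next
      case False
      then have "(of_nat i :: complex) \<noteq> 0" by simp
      note cancel = C_mult_cancel[OF this]
      have "C (of_nat i) * D (L \<alpha> (Suc i)) = C (of_nat i) * scl (c * of_nat (Suc i)) (L \<alpha> (Suc i + 1))"
        using step[OF that, of i]
        unfolding Suc d_scl_vec d_L C_of_nat by (simp add: scl_conv C_simps C_of_nat algebra_simps)
      then show ?thesis
        unfolding cancel .
    qed
  qed
  with that show ?thesis by blast
qed

section \<open>The direct sum decomposition\<close>

lemma Dphi_linear:
  "Dphi \<Gamma> (\<phi> + \<psi>) = Dphi \<Gamma> \<phi> + Dphi \<Gamma> \<psi>"
  "Dphi \<Gamma> (\<lambda>\<gamma>. c * \<phi> \<gamma>) = fscl c (Dphi \<Gamma> \<phi>)"
proof -
  show "Dphi \<Gamma> (\<phi> + \<psi>) = Dphi \<Gamma> \<phi> + Dphi \<Gamma> \<psi>"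
    by (auto simp: Dphi_def fun_eq_iff wvec_vs.scale_left_distrib lin_ext_add_fun)
  have "lin_ext (\<lambda>\<alpha> i. scl (c * \<phi> \<alpha>) (L \<alpha> i)) x = scl c (lin_ext (\<lambda>\<alpha> i. scl (\<phi> \<alpha>) (L \<alpha> i)) x)" for x
    by (simp flip: lin_ext_scl_fun)
  then show "Dphi \<Gamma> (\<lambda>\<gamma>. c * \<phi> \<gamma>) = fscl c (Dphi \<Gamma> \<phi>)"
    by (auto simp: Dphi_def fscl_def fun_eq_iff)
qed

lemma HomZ_closed:
  "0 \<in> HomZ \<Gamma>" "\<phi> \<in> HomZ \<Gamma> \<Longrightarrow> \<psi> \<in> HomZ \<Gamma> \<Longrightarrow> \<phi> + \<psi> \<in> HomZ \<Gamma>"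
  "\<phi> \<in> HomZ \<Gamma> \<Longrightarrow> (\<lambda>\<gamma>. c * \<phi> \<gamma>) \<in> HomZ \<Gamma>"
  by (auto simp: HomZ_def algebra_simps)

lemma Dphi_subspace: "fun_vs.subspace (Dphi \<Gamma> ` HomZ \<Gamma>)"
  unfolding fun_vs.subspace_def
proof (intro conjI ballI allI)
  have "Dphi \<Gamma> 0 = 0" 
    by (auto simp: Dphi_def fun_eq_iff lin_ext_def)
  then show "0 \<in> Dphi \<Gamma> ` HomZ \<Gamma>" using HomZ_closed(1) by (metis image_eqI)
qed (auto simp: HomZ_closed simp flip: Dphi_linear)

lemma ad_linear:
  "ad \<Gamma> (y + z) = ad \<Gamma> y + ad \<Gamma> z" "ad \<Gamma> (scl c z) = fscl c (ad \<Gamma> z)" "ad \<Gamma> 0 = 0"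
  by (auto simp: ad_def fun_eq_iff fscl_def bracket_add_left bracket_scl_left)

lemma adW_subspace: "fun_vs.subspace (adW \<Gamma>)"
  unfolding fun_vs.subspace_def adW_def
proof (intro conjI ballI allI)
  show "0 \<in> ad \<Gamma> ` W \<Gamma>"
    using ad_linear(3) W_closed(1) by (metis image_eqI)
qed (auto simp: W_closed simp flip: ad_linear(1,2))

lemma Der_decomposition:
  assumes G: "additive_subgroup \<Gamma>" "\<Gamma> \<noteq> {0}" and D: "D \<in> Der \<Gamma>"
  obtains z \<phi> where "z \<in> W \<Gamma>" "\<phi> \<in> HomZ \<Gamma>" "D = ad \<Gamma> z + Dphi \<Gamma> \<phi>"
proof -
  have G0: "0 \<in> \<Gamma>" using G by (auto simp: additive_subgroup_def)
  then obtain \<beta> where \<beta>: "\<beta> \<in> \<Gamma>" "\<beta> \<noteq> 0" using G by blast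
  have one: "1 \<in> W \<Gamma>" using L_in_W[of 0 \<Gamma> 0] G0 by (simp add: L_one)
  obtain w where w: "w \<in> W \<Gamma>" "D 1 = bracket w 1"
    using Der_one_inner[OF G(1) D \<beta>] .
  define D' where "D' = D - ad \<Gamma> w"
  have D': "D' \<in> Der \<Gamma>"
    unfolding D'_def by (intro fun_vs.subspace_diff[OF Der_subspace] D ad_in_Der G w)
  have "D' 1 = 0" by (simp add: D'_def w ad_apply one)
  then obtain \<phi> where \<phi>: "\<phi> \<in> HomZ \<Gamma>" "\<And>\<alpha>. \<alpha> \<in> \<Gamma> \<Longrightarrow> D' (X \<alpha>) = scl (\<phi> \<alpha>) (X \<alpha>)"
    using Der_X_eigenvalue[OF G(1) D'] by blast
  define E where "E = D' - Dphi \<Gamma> \<phi>"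
  have E: "E \<in> Der \<Gamma>"
    unfolding E_def by (intro fun_vs.subspace_diff[OF Der_subspace] D' Dphi_in_Der G \<phi>)
  have "E (X \<alpha>) = 0" if "\<alpha> \<in> \<Gamma>" for \<alpha>
    using that by (simp add: E_def \<phi> Dphi_L)
  then obtain c where c: "\<And>\<alpha> i. \<alpha> \<in> \<Gamma> \<Longrightarrow> E (L \<alpha> i) = scl (c * of_nat i) (L \<alpha> (i + 1))"
    using Der_kills_X[OF G E] by blast
  \<comment> \<open>\<open>ad \<Gamma> (scl c 1)\<close> acts as c times \<open>d\<close>; it
    produces the wanted shift in t together with the diagonal term c * \<alpha>, which \<psi>
    cancels.\<close>
  define \<psi> where "\<psi> \<alpha> = (if \<alpha> \<in> \<Gamma> then - c * \<alpha> else 0)" for \<alpha>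
  have \<psi>: "\<psi> \<in> HomZ \<Gamma>"
    using G(1) by (auto simp: HomZ_def \<psi>_def additive_subgroup_def algebra_simps)
  have C1: "scl c 1 \<in> W \<Gamma>" by (intro W_closed one)
  have "E = ad \<Gamma> (scl c 1) + Dphi \<Gamma> \<psi>"
  proof (rule Der_eqI[OF E])
    show "ad \<Gamma> (scl c 1) + Dphi \<Gamma> \<psi> \<in> Der \<Gamma>"
      by (intro fun_vs.subspace_add[OF Der_subspace] ad_in_Der Dphi_in_Der G \<psi> C1)
    show "E (L \<alpha> i) = (ad \<Gamma> (scl c 1) + Dphi \<Gamma> \<psi>) (L \<alpha> i)" if "\<alpha> \<in> \<Gamma>" for \<alpha> i
      using that by (simp add: c ad_apply L_in_W Dphi_L \<psi>_def bracket_scl_left)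
        (simp add: bracket_conv d_L scl_conv C_simps C_of_nat algebra_simps)
  qed
  then have "D = ad \<Gamma> (w + scl c 1) + Dphi \<Gamma> (\<phi> + \<psi>)"
    by (simp add: E_def D'_def ad_linear Dphi_linear algebra_simps)
  then show ?thesis
    by (intro that[of "w + scl c 1" "\<phi> + \<psi>"] W_closed HomZ_closed w \<phi> \<psi> one)
qed

text \<open>Additivity gives \<open>\<phi> 0 = 0\<close>, so both maps kill 1 and \<open>T\<close>.
  Killing 1 means \<open>d z = 0\<close>, which makes z a constant c; killing \<open>T\<close> then
  means that c times \<open>L 0 2\<close> is 0.\<close>

lemma ad_eq_Dphi_imp_0:
  assumes G: "additive_subgroup \<Gamma>" and z: "z \<in> W \<Gamma>" and \<phi>: "\<phi> \<in> HomZ \<Gamma>" and eq: "ad \<Gamma> z = Dphi \<Gamma> \<phi>"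
  shows "ad \<Gamma> z = 0"
proof -
  have G0: "0 \<in> \<Gamma>" using G by (auto simp: additive_subgroup_def)
  have \<phi>0: "\<phi> 0 = 0" using \<phi> G0 by (auto simp: HomZ_def) (metis add_0 add_cancel_right_left)
  have "bracket z 1 = 0"
    using fun_cong[OF eq, of "X 0"] G0 by (simp add: ad_apply L_in_W Dphi_L \<phi>0) (simp add: L_one)
  then have "d z = scl 0 z" by (simp add: bracket_conv)
  from d_eigenvector[OF this] obtain c where c: "z = scl c 1" by (auto simp: L_one)
  have "bracket z T = 0"
    using fun_cong[OF eq, of T] G0 by (simp add: ad_apply L_in_W Dphi_L \<phi>0)
  then have "scl c (L 0 2) = 0"
    by (simp add: c bracket_scl_left) (simp add: bracket_conv d_L C_simps numeral_2_eq_2)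
  from arg_cong[OF this, of "\<lambda>x. Poly_Mapping.lookup x (0, 2)"] have "c = 0"
    by (simp add: L_def)
  then show ?thesis by (simp add: c ad_linear)
qed

lemma Der_direct_sum:
  assumes G: "additive_subgroup \<Gamma>" "\<Gamma> \<noteq> {0}"
  shows "is_direct_sum (Der \<Gamma>) (adW \<Gamma>) (Dphi \<Gamma> ` HomZ \<Gamma>)"
  unfolding is_direct_sum_def
proof (intro conjI Der_subspace adW_subspace Dphi_subspace)
  show "Der \<Gamma> = {a + b |a b. a \<in> adW \<Gamma> \<and> b \<in> Dphi \<Gamma> ` HomZ \<Gamma>}"
  proof (intro subset_antisym subsetI)
    fix D assume "D \<in> Der \<Gamma>"
    then obtain z \<phi> where "z \<in> W \<Gamma>" "\<phi> \<in> HomZ \<Gamma>" "D = ad \<Gamma> z + Dphi \<Gamma> \<phi>"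
      using Der_decomposition[OF G] by metis
    then show "D \<in> {a + b |a b. a \<in> adW \<Gamma> \<and> b \<in> Dphi \<Gamma> ` HomZ \<Gamma>}"
      unfolding adW_def by blast
  next
    fix D assume "D \<in> {a + b |a b. a \<in> adW \<Gamma> \<and> b \<in> Dphi \<Gamma> ` HomZ \<Gamma>}"
    then obtain z \<phi> where "z \<in> W \<Gamma>" "\<phi> \<in> HomZ \<Gamma>" "D = ad \<Gamma> z + Dphi \<Gamma> \<phi>"
      unfolding adW_def by blast
    then show "D \<in> Der \<Gamma>"
      using fun_vs.subspace_add[OF Der_subspace] ad_in_Der[OF G(1)] Dphi_in_Der[OF G(1)] by simp
  qed
  show "adW \<Gamma> \<inter> Dphi \<Gamma> ` HomZ \<Gamma> = {0}"
  proof (intro subset_antisym subsetI)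
    fix D assume "D \<in> adW \<Gamma> \<inter> Dphi \<Gamma> ` HomZ \<Gamma>"
    then obtain z \<phi> where "z \<in> W \<Gamma>" "D = ad \<Gamma> z" "\<phi> \<in> HomZ \<Gamma>" "D = Dphi \<Gamma> \<phi>"
      unfolding adW_def by blast
    then show "D \<in> {0}"
      using ad_eq_Dphi_imp_0[OF G(1), of z \<phi>] by simp
  qed (simp add: fun_vs.subspace_0 adW_subspace Dphi_subspace)
qed

text \<open>This justifies identifying \<open>HomZ \<Gamma>\<close> with its image among the
  derivations.\<close>

lemma Dphi_inj: "inj_on (Dphi \<Gamma>) (HomZ \<Gamma>)"
proof (rule inj_onI, rule ext)
  fix \<phi> \<psi> \<alpha> assume H: "\<phi> \<in> HomZ \<Gamma>" "\<psi> \<in> HomZ \<Gamma>" "Dphi \<Gamma> \<phi> = Dphi \<Gamma> \<psi>"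
  show "\<phi> \<alpha> = \<psi> \<alpha>"
  proof (cases "\<alpha> \<in> \<Gamma>")
    case True
    then have "scl (\<phi> \<alpha>) (X \<alpha>) = scl (\<psi> \<alpha>) (X \<alpha>)"
      using fun_cong[OF H(3), of "X \<alpha>"] by (simp add: Dphi_L)
    from arg_cong[OF this, of "\<lambda>x. Poly_Mapping.lookup x (\<alpha>, 0)"] show ?thesis
      by (simp add: L_def)
  qed (use H in \<open>auto simp: HomZ_def\<close>)
qed

section \<open>The case of the integers\<close>

lemma HomZ_Ints:
  assumes "\<phi> \<in> HomZ \<int>" "\<alpha> \<in> \<int>"
  shows "\<phi> \<alpha> = \<phi> 1 * \<alpha>"
proof -
  have add: "\<phi> (\<alpha> + \<beta>) = \<phi> \<alpha> + \<phi> \<beta>" if "\<alpha> \<in> \<int>" "\<beta> \<in> \<int>" for \<alpha> \<beta>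
    using assms(1) that by (auto simp: HomZ_def)
  obtain n where n: "\<alpha> = of_int n" using assms(2) by (rule Ints_cases)
  have "\<phi> (of_int n) = \<phi> 1 * of_int n"
  proof (induction n rule: int_induct[where k = 0])
    case base
    show ?case using add[of 0 0] by simp
  next
    case (step1 i)
    then show ?case by (simp add: add algebra_simps)
  next
    case (step2 i)
    then show ?case using add[of "of_int i - 1" 1] by (simp add: algebra_simps)
  qed
  then show ?thesis by (simp add: n)
qed

lemma Dphi_HomZ_Ints: "Dphi \<int> ` HomZ \<int> = fun_vs.span {D0}"
proof -
  \<comment> \<open>\<open>D0\<close> is built from the identity on all complex numbers, which is
    not in \<open>HomZ \<int>\<close> as it is nonzero off the integers. Its truncation
    \<open>?id\<close> is, and yields the same map by \<open>cong\<close>.\<close>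
  let ?id = "\<lambda>\<alpha>::complex. if \<alpha> \<in> \<int> then \<alpha> else 0"
  have cong: "Dphi \<int> \<phi> = Dphi \<int> \<psi>" if "\<And>\<alpha>. \<alpha> \<in> \<int> \<Longrightarrow> \<phi> \<alpha> = \<psi> \<alpha>" for \<phi> \<psi>
    using that by (auto simp: Dphi_def fun_eq_iff lin_ext_def W_def intro!: sum.cong)
  have D0: "D0 = Dphi \<int> ?id" unfolding D0_def by (rule cong) auto
  have id: "?id \<in> HomZ \<int>" by (auto simp: HomZ_def)
  have "Dphi \<int> \<phi> = fscl (\<phi> 1) D0" if "\<phi> \<in> HomZ \<int>" for \<phi>
    unfolding D0 Dphi_linear(2)[symmetric] by (rule cong) (simp add: HomZ_Ints[OF that, symmetric])
  moreover have "fscl c D0 \<in> Dphi \<int> ` HomZ \<int>" for c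
    unfolding D0 Dphi_linear(2)[symmetric] by (intro imageI HomZ_closed id)
  ultimately show ?thesis
    unfolding fun_vs.span_singleton by auto
qed

theorem theorem3p1:
  fixes \<Gamma> :: "complex set"
  assumes "additive_subgroup \<Gamma>" and "\<Gamma> \<noteq> {0}"
  shows "(\<forall>\<phi>\<in>HomZ \<Gamma>. \<forall>\<psi>\<in>HomZ \<Gamma>. Dphi \<Gamma> (\<phi> + \<psi>) = Dphi \<Gamma> \<phi> + Dphi \<Gamma> \<psi>)
       \<and> (\<forall>c. \<forall>\<phi>\<in>HomZ \<Gamma>. Dphi \<Gamma> (\<lambda>\<gamma>. c * \<phi> \<gamma>) = fscl c (Dphi \<Gamma> \<phi>))
       \<and> inj_on (Dphi \<Gamma>) (HomZ \<Gamma>)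
       \<and> is_direct_sum (Der \<Gamma>) (adW \<Gamma>) (Dphi \<Gamma> ` HomZ \<Gamma>)
       \<and> (\<Gamma> = \<int> \<longrightarrow> is_direct_sum (Der \<Gamma>) (adW \<Gamma>) (fun_vs.span {D0}))"
proof (intro conjI ballI allI impI Dphi_linear Dphi_inj Der_direct_sum assms)
  assume "\<Gamma> = \<int>"
  with Der_direct_sum[OF assms] show "is_direct_sum (Der \<Gamma>) (adW \<Gamma>) (fun_vs.span {D0})"
    by (simp add: Dphi_HomZ_Ints)
qed

end
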